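(* Let $A\in\mathbb{R}^{n\times n}$, $B\in\mathbb{R}^{n\times m}$, $C\in\mathbb{R}^{p\times n}$ and let $\mathscr{G}$ be a weighted directed graph on $N$ nodes with Laplacian $\mathcal{L}$, and consider the dynamic network $(A,B,C,\mathscr{G})$ described in the context. Let $L_{G}>0$, $L_{K}>0$ and $\varrho\in(0,1)$. Suppose there are positive constants $W$ and $W_u$, independent of $\gamma,\alpha,\alpha_u,L,L_u,G$ and $K$, such that for any given positive constants $C_{x}$, $C_{\hat{x}}$, $C_{\hat{u}}$ there exist a communication protocol $H(\gamma,\alpha,\alpha_{u},L,L_{u},G)\in\mathscr{H}(\varrho,L_{G})$ and a control protocol $U(K)\in\mathscr{U}(L_{K})$ such that for any initial conditions with $\|X(0)\|_\infty<C_{x}$, $\|\hat{X}(0)\|_\infty<C_{\hat{x}}$ and $\|\hat{U}(0)\|_\infty<C_{\hat{u}}$, the closed-loop network achieves inter-agent state observation and cooperative stabilization under $H$ and $U$, and $\sup_{t\ge 0}\max_{1\le j\le N}\|\Delta_{j}(t)\|_{\infty}\le W$ and $\sup_{t\ge 0}\max_{1\le j\le N}\|\Delta_{u,j}(t)\|_{\infty}\le W_{u}$. Then: (A1) there exists $K\in\mathbb{R}^{m\times n}$ such that all eigenvalues of $A-\lambda_{i}(\mathcal{L})BK$, $i=2,\dots,N$, lie in the open unit disk of the complex plane; and (A2) $(A,C)$ is detectable.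
   Context: Agents $i=1,\dots,N$ have dynamics $x_i(t+1)=Ax_i(t)+Bu_i(t)$, $y_i(t)=Cx_i(t)$, $t=0,1,\dots$. The communication graph $\mathscr{G}$ has node set $\{1,\dots,N\}$ and weighted adjacency matrix $\mathscr{A}=[a_{ij}]$ with $a_{ii}=0$, $a_{ij}\ge0$, and $a_{ij}>0$ iff there is a channel from $j$ to $i$; $N_i=\{j: a_{ij}>0\}$. The Laplacian is $\mathcal{L}=\mathrm{diag}(\sum_j a_{1j},\dots,\sum_j a_{Nj})-\mathscr{A}$; its eigenvalues (with multiplicity), in ascending order of real parts, are $\lambda_1(\mathcal{L})=0,\lambda_2(\mathcal{L}),\dots,\lambda_N(\mathcal{L})$. Norms: for a vector, $\|\cdot\|_\infty$ is the max norm; for a matrix, $\|\cdot\|$ is the spectral (Euclidean operator) norm. Quantizer: for $p\in(0,1]$ and a positive integer $M$, $Q_{p,M}(y)=ip$ if $ip-p/2\le y<ip+p/2$, $i=0,1,\dots,M-1$; $Q_{p,M}(y)=Mp$ if $y\ge Mp-p/2$; $Q_{p,M}(y)=-Q_{p,M}(-y)$ if $y<-p/2$; applied componentwise to vectors. Communication protocol set: for $\varrho\in(0,1]$ and $L_G\in\mathbb{R}^+\cup\{+\infty\}$, $\mathscr{H}(\varrho,L_G)$ consists of protocols $H(\gamma,\alpha,\alpha_u,L,L_u,G)$ with $\gamma\in(0,\varrho)$, $\alpha,\alpha_u\in(0,1]$, positive integers $L,L_u$, and $G\in\mathbb{R}^{n\times p}$ with $\|G\|<L_G$. Under such a protocol,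 each agent $j$ runs the encoder: $\hat x_j(0)=\hat x_{j0}$, $\hat u_j(0)=\hat u_{j0}$, and for $t\ge1$: $s_j(t)=Q_{\alpha,L}\big((y_j(t-1)-C\hat x_j(t-1))/\gamma^{t-1}\big)$, $\hat x_j(t)=A\hat x_j(t-1)+\gamma^{t-1}Gs_j(t)+B\hat u_j(t-1)$, $s_{u,j}(t)=Q_{\alpha_u,L_u}\big((u_j(t)-\hat u_j(t-1))/\gamma^{t-1}\big)$, $\hat u_j(t)=\hat u_j(t-1)+\gamma^{t-1}s_{u,j}(t)$; the symbols $s_j(t),s_{u,j}(t)$ are sent over each channel $(j,i)$, and receiver $i$ runs the decoder $\hat x_{ji}(0)=\hat x_{j0}$, $\hat u_{ji}(0)=\hat u_{j0}$, $\hat x_{ji}(t)=A\hat x_{ji}(t-1)+\gamma^{t-1}Gs_j(t)+B\hat u_{ji}(t-1)$, $\hat u_{ji}(t)=\hat u_{ji}(t-1)+\gamma^{t-1}s_{u,j}(t)$ (so $\hat x_{ji}(t)=\hat x_j(t)$). Control protocol set: for $L_K\in\mathbb{R}^+\cup\{+\infty\}$, $\mathscr{U}(L_K)$ consists of protocols $U(K)$, $K\in\mathbb{R}^{m\times n}$ with $\|K\|<L_K$, given by $u_i(t)=K\sum_{j\in N_i}a_{ij}(\hat x_{ji}(t)-\hat x_i(t))$, $t\ge0$. Quantization errors: for $t\ge0$, $\Delta_j(t)=(y_j(t)-C\hat x_j(t))/\gamma^{t}-s_j(t+1)$ and $\Delta_{u,j}(t)=(u_j(t+1)-\hat u_j(t))/\gamma^{t}-s_{u,j}(t+1)$.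 Stacked vectors: $X(t)=(x_1^T(t),\dots,x_N^T(t))^T$, $\hat X(t)=(\hat x_1^T(t),\dots,\hat x_N^T(t))^T$, $\hat U(t)=(\hat u_1^T(t),\dots,\hat u_N^T(t))^T$. Inter-agent state observation means $\lim_{t\to\infty}(x_j(t)-\hat x_j(t))=0$ for all $j=1,\dots,N$. Cooperative stabilization means $\lim_{t\to\infty}(x_i(t)-x_j(t))=0$ for all $i,j=1,\dots,N$. *)

theory Defs
  imports "HOL-Analysis.Analysis" "HOL-Computational_Algebra.Polynomial"
begin

section \<open>Linear-algebra notions\<close>

text \<open>Complexification of a real matrix.\<close>
definition cmat :: "real^'c^'r \<Rightarrow> complex^'c^'r" where
  "cmat M = (\<chi> i j. complex_of_real (M$i$j))"

text \<open>Characteristic polynomial det(zI - M); its roots (with multiplicity = order)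
  are the eigenvalues (with algebraic multiplicity).\<close>
definition charpoly :: "complex^'n^'n \<Rightarrow> complex poly" where
  "charpoly M = det (\<chi> i j. (if i = j then [:0, 1:] else 0) - [:M$i$j:])"

text \<open>All eigenvalues lie in the open unit disk.\<close>
definition schur_stable :: "complex^'n^'n \<Rightarrow> bool" where
  "schur_stable M \<longleftrightarrow> (\<forall>z. poly (charpoly M) z = 0 \<longrightarrow> cmod z < 1)"

text \<open>(A,C) detectable: there is an output injection L with A - L C Schur stable.\<close>
definition detectable :: "real^'n^'n \<Rightarrow> real^'n^'p \<Rightarrow> bool" where
  "detectable A C \<longleftrightarrow> (\<exists>Lo :: real^'p^'n. schur_stable (cmat (A - Lo ** C)))"

text \<open>Graph Laplacian of a weighted adjacency matrix.\<close>
definition laplacian :: "real^'N^'N \<Rightarrow> real^'N^'N" where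
  "laplacian a = (\<chi> i j. (if i = j then (\<Sum>k\<in>UNIV. a$i$k) else 0) - a$i$j)"

text \<open>The set {lambda_2(L),...,lambda_N(L)}: the eigenvalues of L (with multiplicity)
  after removing one copy of lambda_1(L) = 0.\<close>
definition lap_eigs_rest :: "real^'N^'N \<Rightarrow> complex set" where
  "lap_eigs_rest a = {z. order z (charpoly (cmat (laplacian a))) \<ge> (if z = 0 then 2 else 1)}"

text \<open>Max norm over stacked agent vectors.\<close>
definition stack_infnorm :: "('N::finite \<Rightarrow> real^'k) \<Rightarrow> real" where
  "stack_infnorm X = Max (range (\<lambda>j. infnorm (X j)))"

section \<open>Quantizer\<close>

text \<open>Q_{p,M} on y >= -p/2: i*p if i*p - p/2 <= y < i*p + p/2 (i = 0..M-1),
  M*p if y >= M*p - p/2.\<close>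
definition quant_pos :: "real \<Rightarrow> nat \<Rightarrow> real \<Rightarrow> real" where
  "quant_pos p M y = (if y \<ge> real M * p - p/2 then real M * p
                      else p * of_int \<lfloor>y / p + 1/2\<rfloor>)"

definition quant :: "real \<Rightarrow> nat \<Rightarrow> real \<Rightarrow> real" where
  "quant p M y = (if y < - p/2 then - quant_pos p M (- y) else quant_pos p M y)"

definition quantv :: "real \<Rightarrow> nat \<Rightarrow> real^'k \<Rightarrow> real^'k" where
  "quantv p M v = (\<chi> i. quant p M (v$i))"

section \<open>Closed-loop network\<close>

text \<open>Control protocol U(K): u_i = K sum_{j in N_i} a_ij (xhat_ji - xhat_i), with xhat_ji = xhat_j.\<close>
definition ctrl :: "real^'n^'m \<Rightarrow> real^'N^'N \<Rightarrow> ('N::finite \<Rightarrow> real^'n) \<Rightarrow> 'N \<Rightarrow> real^'m" where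
  "ctrl K a xh i = K *v (\<Sum>j\<in>{j. a$i$j > 0}. a$i$j *\<^sub>R (xh j - xh i))"

text \<open>State (x(t), xhat(t), uhat(t)) of all agents at time t.\<close>
primrec cl ::
  "real^'n^'n \<Rightarrow> real^'m^'n \<Rightarrow> real^'n^'p \<Rightarrow> real^'N^'N \<Rightarrow>
   real \<Rightarrow> real \<Rightarrow> real \<Rightarrow> nat \<Rightarrow> nat \<Rightarrow> real^'p^'n \<Rightarrow> real^'n^'m \<Rightarrow>
   ('N::finite \<Rightarrow> real^'n) \<Rightarrow> ('N \<Rightarrow> real^'n) \<Rightarrow> ('N \<Rightarrow> real^'m) \<Rightarrow> nat \<Rightarrow>
   ('N \<Rightarrow> real^'n) \<times> ('N \<Rightarrow> real^'n) \<times> ('N \<Rightarrow> real^'m)" where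
  "cl A B C a \<gamma> \<alpha> \<alpha>u L Lu G K x0 xh0 uh0 0 = (x0, xh0, uh0)"
| "cl A B C a \<gamma> \<alpha> \<alpha>u L Lu G K x0 xh0 uh0 (Suc t) =
     (let (x, xh, uh) = cl A B C a \<gamma> \<alpha> \<alpha>u L Lu G K x0 xh0 uh0 t;
          x' = (\<lambda>j. A *v x j + B *v ctrl K a xh j);
          s = (\<lambda>j. quantv \<alpha> L ((1 / \<gamma>^t) *\<^sub>R (C *v x j - C *v xh j)));
          xh' = (\<lambda>j. A *v xh j + \<gamma>^t *\<^sub>R (G *v s j) + B *v uh j);
          su = (\<lambda>j. quantv \<alpha>u Lu ((1 / \<gamma>^t) *\<^sub>R (ctrl K a xh' j - uh j)));
          uh' = (\<lambda>j. uh j + \<gamma>^t *\<^sub>R su j)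
      in (x', xh', uh'))"

text \<open>Quantization errors Delta_j(t) and Delta_{u,j}(t).\<close>
definition qerr ::
  "real^'n^'n \<Rightarrow> real^'m^'n \<Rightarrow> real^'n^'p \<Rightarrow> real^'N^'N \<Rightarrow>
   real \<Rightarrow> real \<Rightarrow> real \<Rightarrow> nat \<Rightarrow> nat \<Rightarrow> real^'p^'n \<Rightarrow> real^'n^'m \<Rightarrow>
   ('N::finite \<Rightarrow> real^'n) \<Rightarrow> ('N \<Rightarrow> real^'n) \<Rightarrow> ('N \<Rightarrow> real^'m) \<Rightarrow> nat \<Rightarrow> 'N \<Rightarrow> real^'p" where
  "qerr A B C a \<gamma> \<alpha> \<alpha>u L Lu G K x0 xh0 uh0 t j =
     (let (x, xh, uh) = cl A B C a \<gamma> \<alpha> \<alpha>u L Lu G K x0 xh0 uh0 t;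
          e = (1 / \<gamma>^t) *\<^sub>R (C *v x j - C *v xh j)
      in e - quantv \<alpha> L e)"

definition qerr_u ::
  "real^'n^'n \<Rightarrow> real^'m^'n \<Rightarrow> real^'n^'p \<Rightarrow> real^'N^'N \<Rightarrow>
   real \<Rightarrow> real \<Rightarrow> real \<Rightarrow> nat \<Rightarrow> nat \<Rightarrow> real^'p^'n \<Rightarrow> real^'n^'m \<Rightarrow>
   ('N::finite \<Rightarrow> real^'n) \<Rightarrow> ('N \<Rightarrow> real^'n) \<Rightarrow> ('N \<Rightarrow> real^'m) \<Rightarrow> nat \<Rightarrow> 'N \<Rightarrow> real^'m" where
  "qerr_u A B C a \<gamma> \<alpha> \<alpha>u L Lu G K x0 xh0 uh0 t j =
     (let (x, xh, uh) = cl A B C a \<gamma> \<alpha> \<alpha>u L Lu G K x0 xh0 uh0 t;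
          xh' = fst (snd (cl A B C a \<gamma> \<alpha> \<alpha>u L Lu G K x0 xh0 uh0 (Suc t)));
          e = (1 / \<gamma>^t) *\<^sub>R (ctrl K a xh' j - uh j)
      in e - quantv \<alpha>u Lu e)"

end

theory Submission
  imports Defs
begin

text \<open>If a left eigenvector \<open>y\<close> of \<open>A - G C\<close> (or of \<open>A - \<lambda>\<^sub>i(\<L>) B K\<close>, paired with a left
  eigenvector \<open>r\<close> of the Laplacian and corrected by an estimation-error term) had an eigenvalue
  \<open>\<mu>\<close> with \<open>|\<mu>| \<ge> 1\<close>, the corresponding scalar mode \<open>\<zeta>\<close> of the closed loop would satisfy
  \<open>\<zeta>(t+1) = \<mu> \<zeta>(t) + \<delta>(t)\<close>, where \<open>\<delta>\<close> stems only from the quantization errors.  These are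
  bounded by \<open>W\<close>, \<open>W\<^sub>u\<close> and scaled by \<open>\<gamma>\<^sup>t\<close>, so \<open>\<Sum>|\<delta>|\<close> is bounded by a constant that
  does not depend on the initial state.  Observation and cooperative stabilization force
  \<open>\<zeta>(t) \<rightarrow> 0\<close> (\<open>\<Sum> r\<^sub>i = 0\<close> removes the common motion of the agents), hence \<open>|\<zeta>(0)|\<close> is
  bounded by that constant too.  Since the protocols must work for arbitrarily large initial
  states, an initial state with a larger \<open>\<zeta>(0)\<close> gives a contradiction.\<close>

section \<open>Left eigenvectors\<close>

lemma det_eq_0_imp_left_null:
  fixes M :: "complex^'n^'n"
  assumes "det M = 0"
  shows "\<exists>y. y \<noteq> 0 \<and> y v* M = 0"
proof -
  have "\<not> inj ((*v) (transpose M))"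
    using assms det_nz_iff_inj_gen[OF matrix_vector_mul_linear_gen, of "transpose M"] by simp
  then obtain y1 y2 where "y1 \<noteq> y2" "transpose M *v y1 = transpose M *v y2"
    unfolding inj_on_def by blast
  then show ?thesis
    by (intro exI[of _ "y1 - y2"]) (simp add: vector_matrix_mult_diff_distrib)
qed

lemma vector_matrix_mult_mat: "(y::'a::comm_ring_1^'n) v* mat c = c *s y"
  by (simp add: vec_eq_iff vector_matrix_mult_def mat_def if_distrib mult.commute cong: if_cong)

lemma poly_det:
  fixes P :: "complex poly^'n^'n"
  shows "poly (det P) z = det (\<chi> i j. poly (P$i$j) z)"
  unfolding det_def by (simp add: poly_sum poly_prod)

lemma poly_charpoly: "poly (charpoly M) z = det (mat z - M)"
  unfolding charpoly_def poly_det by (rule arg_cong[where f = det]) (simp add: vec_eq_iff mat_def)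

lemma charpoly_root_imp_left_eigenvector:
  fixes M :: "complex^'n^'n"
  assumes "poly (charpoly M) \<mu> = 0"
  shows "\<exists>y. y \<noteq> 0 \<and> y v* M = \<mu> *s y"
proof -
  obtain y where "y \<noteq> 0" "y v* (mat \<mu> - M) = 0"
    using det_eq_0_imp_left_null assms by (metis poly_charpoly)
  then show ?thesis by (auto simp: vector_matrix_mult_diff_rdistrib vector_matrix_mult_mat)
qed

lemma scale_to_unit_max_component:
  fixes y :: "complex^'n"
  assumes "y \<noteq> 0"
  obtains c k where "c \<noteq> 0" "(c *s y)$k = 1" "\<forall>i. cmod ((c *s y)$i) \<le> 1"
proof -
  have "Max (range (\<lambda>i. cmod (y$i))) \<in> range (\<lambda>i. cmod (y$i))"
    by (rule Max_in) auto
  then obtain k where k: "Max (range (\<lambda>i. cmod (y$i))) = cmod (y$k)"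
    by blast
  have le: "cmod (y$i) \<le> cmod (y$k)" for i
    unfolding k[symmetric] by (rule Max_ge) auto
  from assms obtain i where "y$i \<noteq> 0" by (auto simp: vec_eq_iff)
  with le[of i] have "y$k \<noteq> 0" by auto
  with le show ?thesis
    by (intro that[of "1 / y$k" k]) (auto simp: norm_divide divide_le_eq_1)
qed

section \<open>Left eigenvectors of the Laplacian\<close>

lemma det_replace_column_by_row_sums:
  fixes P :: "complex^'n^'n"
  shows "det (\<chi> i j. if j = k then (P *v 1)$i else P$i$j) = det P"
proof -
  define x where "x = (\<Sum>j\<in>UNIV - {k}. row j (transpose P))"
  have x: "x \<in> vec.span {row j (transpose P) |j. j \<noteq> k}"
    unfolding x_def by (intro vec.span_sum) (auto intro: vec.span_base)
  have sum_split: "(\<Sum>j\<in>UNIV. P$i$j) = P$i$k + (\<Sum>j\<in>UNIV - {k}. P$i$j)" for i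
    by (metis (no_types, lifting) finite UNIV_I sum.remove)
  have "(\<chi> m. if m = k then row k (transpose P) + x else row m (transpose P))
      = transpose (\<chi> i j. if j = k then (P *v 1)$i else P$i$j)"
    by (simp add: vec_eq_iff transpose_def row_def x_def matrix_vector_mult_def sum_component sum_split)
  then show ?thesis
    using det_row_span[OF x] by simp
qed

lemma det_constant_row_sums:
  fixes P :: "complex^'n^'n"
  assumes "P *v 1 = c *s 1"
  shows "det P = c * det (\<chi> i j. if j = k then 1 else P$i$j)"
proof -
  have "(\<chi> i j. if j = k then (P *v 1)$i else P$i$j) = (\<chi> i j. if j = k then c * 1 else P$i$j)"
    unfolding assms by (simp add: vec_eq_iff)
  then have "det P = det (transpose (\<chi> i j. if j = k then c * 1 else P$i$j))"
    using det_replace_column_by_row_sums[of k P] by simp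
  also have "transpose (\<chi> i j. if j = k then c * 1 else P$i$j)
      = (\<chi> m. if m = k then c *s 1 else row m (transpose P))"
    by (simp add: vec_eq_iff transpose_def row_def)
  also have "det \<dots> = c * det (\<chi> m. if m = k then 1 else row m (transpose P))"
    by (rule det_row_mul)
  also have "(\<chi> m. if m = k then 1 else row m (transpose P)) = transpose (\<chi> i j. if j = k then 1 else P$i$j)"
    by (simp add: vec_eq_iff transpose_def row_def)
  finally show ?thesis by simp
qed

lemma charpoly_add_ones_column:
  fixes M :: "complex^'n^'n"
  assumes M1: "M *v 1 = 0"
  shows "[:0, 1:] * charpoly (M + (\<chi> i j. if j = k then 1 else 0)) = [:-1, 1:] * charpoly M"
proof -
  define E :: "complex^'n^'n" where "E = (\<chi> i j. if j = k then 1 else 0)"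
  have mat1: "mat w *v 1 = w *s 1" for w :: complex
    by (simp add: vec_eq_iff matrix_vector_mult_def mat_def)
  have E1: "E *v 1 = 1"
    by (simp add: vec_eq_iff matrix_vector_mult_def E_def)
  have "w * det (mat w - (M + E)) = (w - 1) * det (mat w - M)" for w
  proof -
    have "(mat w - M) *v 1 = w *s 1"
      by (simp add: matrix_vector_mult_diff_rdistrib mat1 M1)
    moreover have "(mat w - (M + E)) *v 1 = (w - 1) *s 1"
      by (simp add: matrix_vector_mult_diff_rdistrib matrix_vector_mult_add_rdistrib mat1 M1 E1
          vec_eq_iff algebra_simps)
    moreover have "(\<chi> i j. if j = k then 1 else (mat w - (M + E))$i$j)
        = (\<chi> i j. if j = k then 1 else (mat w - M)$i$j)"
      by (simp add: vec_eq_iff E_def)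
    ultimately show ?thesis
      using det_constant_row_sums[of "mat w - M" w k] det_constant_row_sums[of "mat w - (M + E)" "w - 1" k]
      by simp
  qed
  then show ?thesis
    unfolding E_def[symmetric]
    by (intro poly_eq_poly_eq_iff[THEN iffD1]) (simp add: fun_eq_iff poly_charpoly algebra_simps)
qed

lemma sum_vector_matrix_mult_eq_0:
  fixes M :: "complex^'n^'n"
  assumes "M *v 1 = 0"
  shows "(\<Sum>j\<in>UNIV. (r v* M)$j) = 0"
proof -
  have "(\<Sum>j\<in>UNIV. (r v* M)$j) = (\<Sum>i\<in>UNIV. r$i * (\<Sum>j\<in>UNIV. M$i$j))"
    by (simp add: vector_matrix_mult_def sum_distrib_left) (rule sum.swap)
  also have "\<dots> = 0" using assms by (simp add: vec_eq_iff matrix_vector_mult_def)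
  finally show ?thesis .
qed

text \<open>A double zero eigenvalue survives the rank-one update \<open>M + E\<close> (all ones in column \<open>k\<close>),
  which turns the row sums into \<open>1\<close>; a left null vector of \<open>M + E\<close> is then orthogonal to \<open>1\<close>.\<close>

lemma double_zero_eigenvalue_left_null_vector:
  fixes M :: "complex^'n^'n"
  assumes M1: "M *v 1 = 0" and "order 0 (charpoly M) \<ge> 2"
  shows "\<exists>r. r \<noteq> 0 \<and> r v* M = 0 \<and> (\<Sum>i\<in>UNIV. r$i) = 0"
proof -
  obtain k :: 'n where True by simp
  define E :: "complex^'n^'n" where "E = (\<chi> i j. if j = k then 1 else 0)"
  have "[:0, 1:] ^ 2 dvd charpoly M"
    using assms(2) order_divides[of 0 2 "charpoly M"] by simp
  then have "[:0, 1:] * [:0, 1:] dvd [:-1, 1:] * charpoly M"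
    unfolding power2_eq_square by (rule dvd_mult)
  then have "[:0, 1:] * [:0, 1:] dvd [:0, 1:] * charpoly (M + E)"
    by (simp only: charpoly_add_ones_column[OF M1, of k, folded E_def])
  then have "poly (charpoly (M + E)) 0 = 0"
    by (subst (asm) dvd_mult_cancel_left) (auto simp: poly_eq_0_iff_dvd)
  then obtain r where r: "r \<noteq> 0" "r v* (M + E) = 0"
    using charpoly_root_imp_left_eigenvector by fastforce
  have rE: "(r v* E)$j = (if j = k then (\<Sum>i\<in>UNIV. r$i) else 0)" for j
    by (simp add: vector_matrix_mult_def E_def)
  have "0 = (\<Sum>j\<in>UNIV. (r v* (M + E))$j)" using r by simp
  also have "\<dots> = (\<Sum>i\<in>UNIV. r$i)"
    using sum_vector_matrix_mult_eq_0[OF M1] by (simp add: vector_matrix_mult_add_rdistrib sum.distrib rE)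
  finally have "(\<Sum>i\<in>UNIV. r$i) = 0" by simp
  moreover from this have "r v* E = 0" by (simp add: vec_eq_iff rE)
  ultimately show ?thesis using r by (auto simp: vector_matrix_mult_add_rdistrib)
qed

lemma zero_row_sums_left_eigenvector:
  fixes M :: "complex^'n^'n"
  assumes M1: "M *v 1 = 0" and z: "order z (charpoly M) \<ge> (if z = 0 then 2 else 1)"
  shows "\<exists>r. r \<noteq> 0 \<and> r v* M = z *s r \<and> (\<Sum>i\<in>UNIV. r$i) = 0"
proof (cases "z = 0")
  case True
  then show ?thesis using double_zero_eigenvalue_left_null_vector[OF M1] z by simp
next
  case False
  with z have "poly (charpoly M) z = 0" using order_root by fastforce
  then obtain r where r: "r \<noteq> 0" "r v* M = z *s r"
    using charpoly_root_imp_left_eigenvector by blast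
  have "0 = (\<Sum>j\<in>UNIV. (r v* M)$j)" using sum_vector_matrix_mult_eq_0[OF M1] by simp
  also have "\<dots> = z * (\<Sum>j\<in>UNIV. r$j)" by (simp add: r sum_distrib_left)
  finally show ?thesis using r False by auto
qed

lemma cmat_laplacian_mult_one: "cmat (laplacian a) *v 1 = 0"
proof -
  have "(\<Sum>j\<in>UNIV. laplacian a $i$j) = 0" for i
    unfolding laplacian_def by (simp add: sum_subtractf)
  then have "(\<Sum>j\<in>UNIV. complex_of_real (laplacian a $i$j)) = 0" for i
    by (metis of_real_0 of_real_sum)
  then show ?thesis by (simp add: vec_eq_iff matrix_vector_mult_def cmat_def)
qed

lemma lap_eigs_rest_left_eigenvector:
  assumes "z \<in> lap_eigs_rest a"
  shows "\<exists>r. r \<noteq> 0 \<and> r v* cmat (laplacian a) = z *s r \<and> (\<Sum>i\<in>UNIV. r$i) = 0"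
  using assms zero_row_sums_left_eigenvector[OF cmat_laplacian_mult_one]
  unfolding lap_eigs_rest_def by simp

section \<open>Unstable modes of perturbed recursions\<close>

lemma recursion_tendsto_zero_initial_le:
  fixes \<zeta> \<delta> :: "nat \<Rightarrow> complex"
  assumes rec: "\<And>t. \<zeta> (Suc t) = \<mu> * \<zeta> t + \<delta> t" and \<mu>: "1 \<le> cmod \<mu>"
    and \<delta>: "\<And>t. (\<Sum>s<t. cmod (\<delta> s)) \<le> D" and \<zeta>: "\<zeta> \<longlonglongrightarrow> 0"
  shows "cmod (\<zeta> 0) \<le> D"
proof (rule ccontr)
  assume "\<not> cmod (\<zeta> 0) \<le> D"
  have lower: "cmod (\<zeta> 0) - (\<Sum>s<t. cmod (\<delta> s)) \<le> cmod (\<zeta> t)" for t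
  proof (induction t)
    case (Suc t)
    have "cmod (\<zeta> t) \<le> cmod \<mu> * cmod (\<zeta> t)"
      using \<mu> by (simp add: mult_le_cancel_right1)
    also have "\<dots> \<le> cmod (\<zeta> (Suc t)) + cmod (\<delta> t)"
      using norm_triangle_ineq4[of "\<zeta> (Suc t)" "\<delta> t"] by (simp add: rec norm_mult)
    finally show ?case using Suc.IH by simp
  qed simp
  have "eventually (\<lambda>t. cmod (\<zeta> t) < cmod (\<zeta> 0) - D) sequentially"
    using tendsto_norm_zero[OF \<zeta>] \<open>\<not> cmod (\<zeta> 0) \<le> D\<close> by (intro order_tendstoD) auto
  then obtain t where "cmod (\<zeta> t) < cmod (\<zeta> 0) - D"
    by (auto simp: eventually_sequentially)
  with lower[of t] \<delta>[of t] show False by simp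
qed

lemma sum_geometric_shift_le:
  fixes \<gamma> cG cB :: real
  assumes "0 < \<gamma>" "\<gamma> < 1" "0 \<le> cG" "0 \<le> cB"
  shows "(\<Sum>s<t. cG * \<gamma>^s + cB * (if s = 0 then 0 else \<gamma>^(s - 1))) \<le> (cG + cB) / (1 - \<gamma>)"
proof -
  have geom: "(\<Sum>s<t. \<gamma>^s) \<le> 1 / (1 - \<gamma>)" for t
    using assms by (simp add: sum_gp_strict divide_right_mono)
  have shifted: "(\<Sum>s<t. if s = 0 then 0 else \<gamma>^(s - 1)) \<le> 1 / (1 - \<gamma>)"
  proof (cases t)
    case (Suc t')
    then have "(\<Sum>s<t. if s = 0 then 0 else \<gamma>^(s - 1)) = (\<Sum>s<t'. \<gamma>^s)"
      unfolding Suc sum.lessThan_Suc_shift by simp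
    then show ?thesis using geom by simp
  qed (use assms in simp)
  have "(\<Sum>s<t. cG * \<gamma>^s + cB * (if s = 0 then 0 else \<gamma>^(s - 1)))
      = cG * (\<Sum>s<t. \<gamma>^s) + cB * (\<Sum>s<t. if s = 0 then 0 else \<gamma>^(s - 1))"
    by (simp add: sum.distrib sum_distrib_left)
  also have "\<dots> \<le> cG * (1 / (1 - \<gamma>)) + cB * (1 / (1 - \<gamma>))"
    using geom shifted assms by (intro add_mono mult_left_mono) auto
  finally show ?thesis by (simp add: add_divide_distrib)
qed

section \<open>Pairing real states with complex left eigenvectors\<close>

definition cvec :: "real^'k \<Rightarrow> complex^'k" where
  "cvec v = (\<chi> i. complex_of_real (v$i))"

text \<open>Bilinear rather than sesquilinear, so that a left eigenvector \<open>y\<close> of \<open>M\<close> with eigenvalue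
  \<open>\<mu>\<close> gives \<open>cdot y (M *v v) = \<mu> * cdot y v\<close>.\<close>

definition cdot :: "complex^'k \<Rightarrow> complex^'k \<Rightarrow> complex" where
  "cdot y v = (\<Sum>i\<in>UNIV. y$i * v$i)"

lemma cvec_add [simp]: "cvec (u + v) = cvec u + cvec v"
  and cvec_diff [simp]: "cvec (u - v) = cvec u - cvec v"
  and cvec_minus [simp]: "cvec (- v) = - cvec v"
  and cvec_zero [simp]: "cvec 0 = 0"
  and cvec_scaleR [simp]: "cvec (c *\<^sub>R v) = complex_of_real c *s cvec v"
  and cvec_matrix_vector_mult [simp]: "cvec (M *v v) = cmat M *v cvec v"
  by (simp_all add: cvec_def cmat_def vec_eq_iff matrix_vector_mult_def)

lemma cvec_sum: "cvec (sum f S) = (\<Sum>x\<in>S. cvec (f x))"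
  by (induction S rule: infinite_finite_induct) auto

lemma cmat_diff [simp]: "cmat (M - N) = cmat M - cmat N"
  and cmat_matrix_mult [simp]: "cmat (M ** N) = cmat M ** cmat N"
  by (simp_all add: cmat_def vec_eq_iff matrix_matrix_mult_def)

lemma cdot_add [simp]: "cdot y (u + v) = cdot y u + cdot y v"
  and cdot_diff [simp]: "cdot y (u - v) = cdot y u - cdot y v"
  and cdot_minus [simp]: "cdot y (- v) = - cdot y v"
  and cdot_zero [simp]: "cdot y 0 = 0"
  and cdot_scalar [simp]: "cdot y (c *s v) = c * cdot y v"
  and cdot_scalar_left [simp]: "cdot (c *s y) v = c * cdot y v"
  and cdot_add_left: "cdot (y + w) v = cdot y v + cdot w v"
  and cdot_diff_left: "cdot (y - w) v = cdot y v - cdot w v"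
  by (simp_all add: cdot_def sum.distrib sum_subtractf sum_negf sum_distrib_left algebra_simps)

lemma cdot_sum: "cdot y (sum f S) = (\<Sum>x\<in>S. cdot y (f x))"
  by (induction S rule: infinite_finite_induct) auto

lemma cdot_matrix_vector_mult: "cdot y (M *v v) = cdot (y v* M) v"
  unfolding cdot_def matrix_vector_mult_def vector_matrix_mult_def
  by (simp add: sum_distrib_left sum_distrib_right mult.assoc mult.left_commute) (rule sum.swap)

lemma cdot_cvec_axis: "cdot y (cvec (axis k c)) = complex_of_real c * y$k"
  by (simp add: cdot_def cvec_def axis_def if_distrib cong: if_cong)

lemma norm_cdot_cvec_le:
  assumes "\<forall>i. cmod (y$i) \<le> 1"
  shows "cmod (cdot y (cvec v)) \<le> (\<Sum>i\<in>UNIV. \<bar>v$i\<bar>)"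
proof -
  have "cmod (cdot y (cvec v)) \<le> (\<Sum>i\<in>UNIV. cmod (y$i * cvec v $ i))"
    unfolding cdot_def by (rule norm_sum)
  also have "\<dots> = (\<Sum>i\<in>UNIV. cmod (y$i) * \<bar>v$i\<bar>)"
    by (simp add: cvec_def norm_mult)
  also have "\<dots> \<le> (\<Sum>i\<in>UNIV. \<bar>v$i\<bar>)"
    using assms by (intro sum_mono) (simp add: mult_left_le_one_le)
  finally show ?thesis .
qed

lemma cdot_cvec_tendsto_zero:
  assumes "f \<longlonglongrightarrow> 0"
  shows "(\<lambda>t. cdot y (cvec (f t))) \<longlonglongrightarrow> 0"
proof -
  have "(\<lambda>t. \<Sum>i\<in>UNIV. y$i * complex_of_real (f t $ i)) \<longlonglongrightarrow> (\<Sum>i\<in>UNIV. y$i * complex_of_real 0)"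
    using tendsto_vec_nth[OF assms] by (intro tendsto_intros) simp
  then show ?thesis by (simp add: cdot_def cvec_def)
qed

lemma sum_norm_cdot_cvec_le:
  fixes v :: "nat \<Rightarrow> real^'k" and D :: real
  assumes "\<forall>i. cmod (y$i) \<le> 1" and "\<And>i. (\<Sum>s<t. \<bar>v s $ i\<bar>) \<le> D"
  shows "(\<Sum>s<t. cmod (cdot y (cvec (v s)))) \<le> CARD('k) * D"
proof -
  have "(\<Sum>s<t. cmod (cdot y (cvec (v s)))) \<le> (\<Sum>s<t. \<Sum>i\<in>UNIV. \<bar>v s $ i\<bar>)"
    using assms(1) by (intro sum_mono norm_cdot_cvec_le)
  also have "\<dots> = (\<Sum>i\<in>UNIV. \<Sum>s<t. \<bar>v s $ i\<bar>)"
    by (rule sum.swap)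
  also have "\<dots> \<le> (\<Sum>i\<in>(UNIV::'k set). D)"
    using assms(2) by (intro sum_mono)
  finally show ?thesis by simp
qed

section \<open>Bounds on the control law\<close>

lemma infnorm_cart_le:
  fixes v :: "real^'k"
  assumes "\<forall>i. \<bar>v$i\<bar> \<le> c"
  shows "infnorm v \<le> c"
  unfolding infnorm_cart using assms by (intro cSup_least) auto

lemma stack_infnorm_less:
  assumes "\<forall>j. infnorm (X j) \<le> c" "c < C"
  shows "stack_infnorm X < C"
  unfolding stack_infnorm_def using assms by (subst Max_less_iff) (auto intro: le_less_trans)

lemma abs_matrix_vector_mult_nth_le:
  fixes M :: "real^'a^'b"
  assumes "infnorm v \<le> c"
  shows "\<bar>(M *v v)$i\<bar> \<le> onorm ((*v) M) * (sqrt CARD('a) * c)"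
proof -
  have "\<bar>(M *v v)$i\<bar> \<le> onorm ((*v) M) * norm v"
    using component_le_norm_cart onorm[OF matrix_vector_mul_bounded_linear] order_trans by blast
  also have "\<dots> \<le> onorm ((*v) M) * (sqrt CARD('a) * c)"
  proof (rule mult_left_mono)
    have "norm v \<le> sqrt DIM(real^'a) * infnorm v" by (rule norm_le_infnorm)
    also have "\<dots> \<le> sqrt CARD('a) * c" using assms by (simp add: mult_left_mono)
    finally show "norm v \<le> sqrt CARD('a) * c" .
  qed (rule onorm_pos_le[OF matrix_vector_mul_bounded_linear])
  finally show ?thesis .
qed

lemma matrix_vector_mult_uminus_right: "(M::'a::ring_1^'n^'m) *v (- v) = - (M *v v)"
  by (simp add: vec_eq_iff matrix_vector_mult_def sum_negf)

lemma ctrl_eq_laplacian: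
  fixes a :: "real^'N::finite^'N"
  assumes nonneg: "\<forall>i j. a$i$j \<ge> 0"
  shows "ctrl K a xh i = - (K *v (\<Sum>j\<in>UNIV. laplacian a $i$j *\<^sub>R xh j))"
proof -
  have "(\<Sum>j\<in>{j. a$i$j > 0}. a$i$j *\<^sub>R (xh j - xh i)) = (\<Sum>j\<in>UNIV. a$i$j *\<^sub>R (xh j - xh i))"
    using nonneg by (intro sum.mono_neutral_left) (auto simp: not_less intro: antisym)
  also have "\<dots> = - (\<Sum>j\<in>UNIV. laplacian a $i$j *\<^sub>R xh j)"
    by (simp add: laplacian_def scaleR_diff_right scaleR_left_diff_distrib sum_subtractf
        scaleR_sum_left if_distrib[of "\<lambda>x. x *\<^sub>R _"] cong: if_cong)
  finally show ?thesis by (simp add: ctrl_def matrix_vector_mult_uminus_right)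
qed

lemma infnorm_ctrl_le:
  fixes a :: "real^'N::finite^'N" and K :: "real^'n^'m"
  assumes nonneg: "\<forall>i j. a$i$j \<ge> 0" and xh: "\<forall>j l. \<bar>xh j $ l\<bar> \<le> s"
  shows "infnorm (ctrl K a xh i) \<le> onorm ((*v) K) * (sqrt CARD('n) * (2 * s * (\<Sum>i\<in>UNIV. \<Sum>j\<in>UNIV. a$i$j)))"
  unfolding ctrl_def
proof (intro infnorm_cart_le allI abs_matrix_vector_mult_nth_le)
  fix l
  have "\<bar>(\<Sum>j\<in>{j. a$i$j > 0}. a$i$j *\<^sub>R (xh j - xh i)) $ l\<bar> \<le> (\<Sum>j\<in>{j. a$i$j > 0}. a$i$j * (2 * s))"
    unfolding sum_component
  proof (rule sum_abs[THEN order_trans], rule sum_mono)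
    fix j
    have "\<bar>xh j $ l - xh i $ l\<bar> \<le> 2 * s" using xh[rule_format, of j l] xh[rule_format, of i l] by linarith
    then show "\<bar>(a$i$j *\<^sub>R (xh j - xh i)) $ l\<bar> \<le> a$i$j * (2 * s)"
      using nonneg by (simp add: abs_mult mult_left_mono)
  qed
  also have "\<dots> = (\<Sum>j\<in>{j. a$i$j > 0}. a$i$j) * (2 * s)"
    by (simp add: sum_distrib_right)
  also have "\<dots> \<le> (\<Sum>j\<in>UNIV. a$i$j) * (2 * s)"
    using nonneg xh[rule_format, of i l] by (intro mult_right_mono sum_mono2) auto
  also have "\<dots> \<le> (\<Sum>i\<in>UNIV. \<Sum>j\<in>UNIV. a$i$j) * (2 * s)"
    using nonneg xh[rule_format, of i l]
    by (intro mult_right_mono member_le_sum) (auto intro: sum_nonneg)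
  finally show "\<bar>(\<Sum>j\<in>{j. a$i$j > 0}. a$i$j *\<^sub>R (xh j - xh i)) $ l\<bar>
      \<le> 2 * s * (\<Sum>i\<in>UNIV. \<Sum>j\<in>UNIV. a$i$j)"
    by (simp add: mult.commute)
qed

lemma abs_axis_nth_le: "0 \<le> s \<Longrightarrow> \<bar>axis k s $ l\<bar> \<le> (s::real)"
  by (simp add: axis_def)

lemma stack_infnorm_le_less:
  assumes "\<forall>j l. \<bar>X j $ l\<bar> \<le> s" "s < C"
  shows "stack_infnorm X < C"
  using assms by (intro stack_infnorm_less[of _ s] allI infnorm_cart_le) auto

lemma stack_infnorm_zero_less: "0 < C \<Longrightarrow> stack_infnorm (\<lambda>j. 0) < C"
  by (rule stack_infnorm_le_less) auto

lemma stack_infnorm_ctrl_less: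
  fixes a :: "real^'N::finite^'N" and K :: "real^'n^'m"
  assumes "\<forall>i j. a$i$j \<ge> 0" "\<forall>j l. \<bar>xh j $ l\<bar> \<le> s" "onorm ((*v) K) \<le> LK"
    and "LK * (sqrt CARD('n) * (2 * s * (\<Sum>i\<in>UNIV. \<Sum>j\<in>UNIV. a$i$j))) < Cu"
  shows "stack_infnorm (ctrl K a xh) < Cu"
proof (rule stack_infnorm_less[OF allI assms(4)])
  fix j
  define S where "S = sqrt CARD('n) * (2 * s * (\<Sum>i\<in>UNIV. \<Sum>j\<in>UNIV. a$i$j))"
  have "0 \<le> s" using assms(2) by (meson abs_ge_zero order_trans)
  moreover have "0 \<le> (\<Sum>i\<in>UNIV. \<Sum>j\<in>UNIV. a$i$j)"
    using assms(1) by (simp add: sum_nonneg)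
  ultimately have "0 \<le> S" by (simp add: S_def)
  have "infnorm (ctrl K a xh j) \<le> onorm ((*v) K) * S"
    unfolding S_def by (rule infnorm_ctrl_le[OF assms(1,2)])
  also have "\<dots> \<le> LK * S"
    using \<open>0 \<le> S\<close> assms(3) by (rule mult_right_mono[rotated])
  finally show "infnorm (ctrl K a xh j) \<le> LK * S" .
qed

section \<open>The quantized closed loop\<close>

definition drift_bound :: "real^'m^'n \<Rightarrow> real^'p^'n \<Rightarrow> real \<Rightarrow> real \<Rightarrow> real \<Rightarrow> real" where
  "drift_bound B G W Wu \<gamma> =
     (onorm ((*v) G) * (sqrt CARD('p) * W) + onorm ((*v) B) * (sqrt CARD('m) * Wu)) / (1 - \<gamma>)"

lemma drift_bound_le:
  fixes B :: "real^'m^'n" and G :: "real^'p^'n"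
  assumes "onorm ((*v) G) \<le> LG" "0 < \<gamma>" "\<gamma> \<le> \<rho>" "\<rho> < 1" "0 \<le> W" "0 \<le> Wu"
  shows "drift_bound B G W Wu \<gamma>
    \<le> (LG * (sqrt CARD('p) * W) + onorm ((*v) B) * (sqrt CARD('m) * Wu)) / (1 - \<rho>)"
proof -
  have G0: "0 \<le> onorm ((*v) G)" and B0: "0 \<le> onorm ((*v) B)"
    by (simp_all add: onorm_pos_le[OF matrix_vector_mul_bounded_linear])
  have "onorm ((*v) G) * (sqrt CARD('p) * W) \<le> LG * (sqrt CARD('p) * W)"
    using assms by (simp add: mult_right_mono)
  moreover have "0 \<le> onorm ((*v) G) * (sqrt CARD('p) * W)" "0 \<le> onorm ((*v) B) * (sqrt CARD('m) * Wu)"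
    using G0 B0 assms by simp_all
  moreover have "0 \<le> LG * (sqrt CARD('p) * W)"
    using G0 assms by simp
  ultimately show ?thesis
    unfolding drift_bound_def using assms by (intro frac_le) auto
qed

definition protocol_achieves ::
  "real^'n^'n \<Rightarrow> real^'m^'n \<Rightarrow> real^'n^'p \<Rightarrow> real^'N::finite^'N \<Rightarrow>
   real \<Rightarrow> real \<Rightarrow> real \<Rightarrow> nat \<Rightarrow> nat \<Rightarrow> real^'p^'n \<Rightarrow> real^'n^'m \<Rightarrow>
   real \<Rightarrow> real \<Rightarrow> real \<Rightarrow> real \<Rightarrow> real \<Rightarrow> bool" where
  "protocol_achieves A B C a \<gamma> \<alpha> \<alpha>u L Lu G K W Wu Cx Cxh Cuh \<longleftrightarrow>
     (\<forall>(x0::'N \<Rightarrow> real^'n) (xh0::'N \<Rightarrow> real^'n) (uh0::'N \<Rightarrow> real^'m).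
        stack_infnorm x0 < Cx \<and> stack_infnorm xh0 < Cxh \<and> stack_infnorm uh0 < Cuh \<longrightarrow>
        (\<forall>j. (\<lambda>t. fst (cl A B C a \<gamma> \<alpha> \<alpha>u L Lu G K x0 xh0 uh0 t) j
                  - fst (snd (cl A B C a \<gamma> \<alpha> \<alpha>u L Lu G K x0 xh0 uh0 t)) j) \<longlonglongrightarrow> 0) \<and>
        (\<forall>i j. (\<lambda>t. fst (cl A B C a \<gamma> \<alpha> \<alpha>u L Lu G K x0 xh0 uh0 t) i
                  - fst (cl A B C a \<gamma> \<alpha> \<alpha>u L Lu G K x0 xh0 uh0 t) j) \<longlonglongrightarrow> 0) \<and>
        (\<forall>t j. infnorm (qerr A B C a \<gamma> \<alpha> \<alpha>u L Lu G K x0 xh0 uh0 t j) \<le> W) \<and>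
        (\<forall>t j. infnorm (qerr_u A B C a \<gamma> \<alpha> \<alpha>u L Lu G K x0 xh0 uh0 t j) \<le> Wu))"

locale quantized_closed_loop =
  fixes A :: "real^'n^'n" and B :: "real^'m^'n" and C :: "real^'n^'p" and a :: "real^'N::finite^'N"
    and \<gamma> \<alpha> \<alpha>u :: real and L Lu :: nat and G :: "real^'p^'n" and K :: "real^'n^'m"
    and x0 xh0 :: "'N \<Rightarrow> real^'n" and uh0 :: "'N \<Rightarrow> real^'m"
  assumes gamma_pos: "0 < \<gamma>"
begin

definition X :: "nat \<Rightarrow> 'N \<Rightarrow> real^'n" where
  "X t = fst (cl A B C a \<gamma> \<alpha> \<alpha>u L Lu G K x0 xh0 uh0 t)"

definition XH :: "nat \<Rightarrow> 'N \<Rightarrow> real^'n" where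
  "XH t = fst (snd (cl A B C a \<gamma> \<alpha> \<alpha>u L Lu G K x0 xh0 uh0 t))"

definition UH :: "nat \<Rightarrow> 'N \<Rightarrow> real^'m" where
  "UH t = snd (snd (cl A B C a \<gamma> \<alpha> \<alpha>u L Lu G K x0 xh0 uh0 t))"

definition E :: "nat \<Rightarrow> 'N \<Rightarrow> real^'n" where
  "E t j = X t j - XH t j"

definition Q :: "nat \<Rightarrow> 'N \<Rightarrow> real^'p" where
  "Q t j = qerr A B C a \<gamma> \<alpha> \<alpha>u L Lu G K x0 xh0 uh0 t j"

definition QU :: "nat \<Rightarrow> 'N \<Rightarrow> real^'m" where
  "QU t j = qerr_u A B C a \<gamma> \<alpha> \<alpha>u L Lu G K x0 xh0 uh0 t j"

definition drift :: "nat \<Rightarrow> 'N \<Rightarrow> real^'n" where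
  "drift t j = E (Suc t) j - (A - G ** C) *v E t j"

lemma cl_eq: "cl A B C a \<gamma> \<alpha> \<alpha>u L Lu G K x0 xh0 uh0 t = (X t, XH t, UH t)"
  by (simp add: X_def XH_def UH_def)

lemma X_0: "X 0 = x0" and XH_0: "XH 0 = xh0" and UH_0: "UH 0 = uh0"
  by (simp_all add: X_def XH_def UH_def)

lemma X_Suc: "X (Suc t) j = A *v X t j + B *v ctrl K a (XH t) j"
  by (simp add: X_def[of "Suc t"] cl_eq Let_def)

lemma XH_Suc: "XH (Suc t) j = A *v XH t j
    + \<gamma>^t *\<^sub>R (G *v quantv \<alpha> L ((1 / \<gamma>^t) *\<^sub>R (C *v X t j - C *v XH t j))) + B *v UH t j"
  by (simp add: XH_def[of "Suc t"] cl_eq Let_def)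

lemma ctrl_minus_UH_Suc: "ctrl K a (XH (Suc t)) j - UH (Suc t) j = \<gamma>^t *\<^sub>R QU t j"
proof -
  have UH_Suc: "UH (Suc t) j = UH t j
      + \<gamma>^t *\<^sub>R quantv \<alpha>u Lu ((1 / \<gamma>^t) *\<^sub>R (ctrl K a (XH (Suc t)) j - UH t j))"
    by (simp add: UH_def[of "Suc t"] XH_def[of "Suc t"] cl_eq Let_def)
  have QU_eq: "QU t j = (1 / \<gamma>^t) *\<^sub>R (ctrl K a (XH (Suc t)) j - UH t j)
      - quantv \<alpha>u Lu ((1 / \<gamma>^t) *\<^sub>R (ctrl K a (XH (Suc t)) j - UH t j))"
    by (simp add: QU_def qerr_u_def cl_eq Let_def XH_def[of "Suc t"])
  show ?thesis unfolding UH_Suc QU_eq using gamma_pos by (simp add: algebra_simps)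
qed

lemma drift_eq: "drift t j = \<gamma>^t *\<^sub>R (G *v Q t j) + B *v (ctrl K a (XH t) j - UH t j)"
proof -
  define e where "e = (1 / \<gamma>^t) *\<^sub>R (C *v X t j - C *v XH t j)"
  have "Q t j = e - quantv \<alpha> L e"
    by (simp add: Q_def qerr_def cl_eq Let_def e_def)
  then have "\<gamma>^t *\<^sub>R (G *v quantv \<alpha> L e) = G *v (C *v E t j) - \<gamma>^t *\<^sub>R (G *v Q t j)"
    using gamma_pos
    by (simp add: e_def E_def matrix_vector_mult_diff_distrib matrix_vector_mult_scaleR scaleR_diff_right)
  then show ?thesis
    unfolding drift_def E_def X_Suc XH_Suc e_def[symmetric]
    by (simp add: matrix_vector_mult_diff_distrib matrix_vector_mult_diff_rdistrib
        matrix_vector_mul_assoc algebra_simps)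
qed


lemma protocol_achievesD:
  assumes "protocol_achieves A B C a \<gamma> \<alpha> \<alpha>u L Lu G K W Wu Cx Cxh Cuh"
    and "stack_infnorm x0 < Cx" "stack_infnorm xh0 < Cxh" "stack_infnorm uh0 < Cuh"
  shows "\<forall>j. (\<lambda>t. E t j) \<longlonglongrightarrow> 0" and "\<forall>i j. (\<lambda>t. X t i - X t j) \<longlonglongrightarrow> 0"
    and "\<forall>t j. infnorm (Q t j) \<le> W" and "\<forall>t j. infnorm (QU t j) \<le> Wu"
  using assms unfolding protocol_achieves_def E_def X_def XH_def Q_def QU_def by blast+

lemma abs_drift_le:
  assumes W: "\<forall>t j. infnorm (Q t j) \<le> W" and Wu: "\<forall>t j. infnorm (QU t j) \<le> Wu"
    and init: "\<forall>j. uh0 j = ctrl K a xh0 j"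
  shows "\<bar>drift t j $ i\<bar> \<le> onorm ((*v) G) * (sqrt CARD('p) * W) * \<gamma>^t
      + onorm ((*v) B) * (sqrt CARD('m) * Wu) * (if t = 0 then 0 else \<gamma>^(t - 1))"
proof -
  have G_part: "\<bar>(G *v Q t j)$i\<bar> \<le> onorm ((*v) G) * (sqrt CARD('p) * W)"
    using W by (intro abs_matrix_vector_mult_nth_le) auto
  have B_part: "\<bar>(B *v (ctrl K a (XH t) j - UH t j))$i\<bar>
      \<le> onorm ((*v) B) * (sqrt CARD('m) * Wu) * (if t = 0 then 0 else \<gamma>^(t - 1))"
  proof (cases t)
    case 0
    then show ?thesis using init by (simp add: XH_0 UH_0)
  next
    case (Suc t')
    have "\<bar>(B *v QU t' j)$i\<bar> \<le> onorm ((*v) B) * (sqrt CARD('m) * Wu)"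
      using Wu by (intro abs_matrix_vector_mult_nth_le) auto
    then show ?thesis
      using gamma_pos unfolding Suc ctrl_minus_UH_Suc
      by (simp add: matrix_vector_mult_scaleR abs_mult mult_left_mono mult.commute)
  qed
  have "\<bar>drift t j $ i\<bar> \<le> \<gamma>^t * \<bar>(G *v Q t j)$i\<bar> + \<bar>(B *v (ctrl K a (XH t) j - UH t j))$i\<bar>"
    unfolding drift_eq using gamma_pos by (simp add: abs_mult abs_triangle_ineq[THEN order_trans])
  also have "\<dots> \<le> \<gamma>^t * (onorm ((*v) G) * (sqrt CARD('p) * W))
      + onorm ((*v) B) * (sqrt CARD('m) * Wu) * (if t = 0 then 0 else \<gamma>^(t - 1))"
    using G_part B_part gamma_pos by (intro add_mono mult_left_mono) auto
  finally show ?thesis by (simp add: algebra_simps)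
qed

lemma sum_abs_drift_le:
  assumes W: "\<forall>t j. infnorm (Q t j) \<le> W" and Wu: "\<forall>t j. infnorm (QU t j) \<le> Wu"
    and init: "\<forall>j. uh0 j = ctrl K a xh0 j" and "\<gamma> < 1"
  shows "(\<Sum>s<t. \<bar>drift s j $ i\<bar>) \<le> drift_bound B G W Wu \<gamma>"
proof -
  have "0 \<le> W" "0 \<le> Wu"
    using W Wu infnorm_pos_le order_trans by blast+
  then have "0 \<le> onorm ((*v) G) * (sqrt CARD('p) * W)" "0 \<le> onorm ((*v) B) * (sqrt CARD('m) * Wu)"
    by (simp_all add: onorm_pos_le[OF matrix_vector_mul_bounded_linear])
  note geometric = sum_geometric_shift_le[OF gamma_pos \<open>\<gamma> < 1\<close> this]
  have "(\<Sum>s<t. \<bar>drift s j $ i\<bar>) \<le> (\<Sum>s<t. onorm ((*v) G) * (sqrt CARD('p) * W) * \<gamma>^s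
      + onorm ((*v) B) * (sqrt CARD('m) * Wu) * (if s = 0 then 0 else \<gamma>^(s - 1)))"
    by (intro sum_mono abs_drift_le[OF W Wu init])
  also have "\<dots> \<le> drift_bound B G W Wu \<gamma>"
    using geometric by (simp add: drift_bound_def mult.commute)
  finally show ?thesis .
qed

lemma observer_mode_initial_le:
  fixes D :: real
  assumes drift: "\<And>t i. (\<Sum>s<t. \<bar>drift s j $ i\<bar>) \<le> D" and E: "(\<lambda>t. E t j) \<longlonglongrightarrow> 0"
    and y: "y v* cmat (A - G ** C) = \<mu> *s y" "\<forall>i. cmod (y$i) \<le> 1" and \<mu>: "1 \<le> cmod \<mu>"
  shows "cmod (cdot y (cvec (E 0 j))) \<le> CARD('n) * D"
proof (rule recursion_tendsto_zero_initial_le[OF _ \<mu>])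
  fix t
  have "E (Suc t) j = (A - G ** C) *v E t j + drift t j"
    by (simp add: drift_def)
  then show "cdot y (cvec (E (Suc t) j)) = \<mu> * cdot y (cvec (E t j)) + cdot y (cvec (drift t j))"
    by (simp only: cvec_add cdot_add cvec_matrix_vector_mult cdot_matrix_vector_mult y(1) cdot_scalar_left)
  show "(\<Sum>s<t. cmod (cdot y (cvec (drift s j)))) \<le> CARD('n) * D"
    using y(2) drift by (rule sum_norm_cdot_cvec_le)
qed (rule cdot_cvec_tendsto_zero[OF E])


definition consensus_mode :: "complex^'N \<Rightarrow> complex^'n \<Rightarrow> complex^'n \<Rightarrow> nat \<Rightarrow> complex" where
  "consensus_mode r y q t = (\<Sum>j\<in>UNIV. r$j * (cdot y (cvec (X t j)) + cdot q (cvec (E t j))))"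

lemma cdot_ctrl_laplacian:
  assumes nonneg: "\<forall>i j. a$i$j \<ge> 0"
  shows "cdot y (cvec (B *v ctrl K a xh i))
    = - (\<Sum>j\<in>UNIV. cmat (laplacian a) $i$j * cdot (y v* (cmat B ** cmat K)) (cvec (xh j)))"
proof -
  have "cdot y (cvec (B *v ctrl K a xh i))
      = - cdot (y v* (cmat B ** cmat K)) (cvec (\<Sum>j\<in>UNIV. laplacian a $i$j *\<^sub>R xh j))"
    unfolding ctrl_eq_laplacian[OF nonneg]
    by (simp add: matrix_vector_mult_uminus_right cdot_matrix_vector_mult vector_matrix_mul_assoc)
  then show ?thesis by (simp add: cvec_sum cdot_sum cmat_def)
qed

text \<open>The vector \<open>q\<close> is chosen so that the coupling term \<open>z (y B K) \<cdot> e\<close> of the state part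
  is cancelled by the estimation-error part.\<close>

lemma consensus_mode_Suc:
  assumes nonneg: "\<forall>i j. a$i$j \<ge> 0"
    and r: "r v* cmat (laplacian a) = z *s r"
    and y: "y v* (cmat A - mat z ** cmat B ** cmat K) = \<mu> *s y"
    and q: "q v* (mat \<mu> - cmat (A - G ** C)) = z *s (y v* (cmat B ** cmat K))"
  shows "consensus_mode r y q (Suc t)
    = \<mu> * consensus_mode r y q t + (\<Sum>j\<in>UNIV. r$j * cdot q (cvec (drift t j)))"
proof -
  define h where "h = y v* (cmat B ** cmat K)"
  define Lc where "Lc = cmat (laplacian a)"
  have yA: "y v* cmat A = \<mu> *s y + z *s h"
  proof -
    have "y v* (mat z ** cmat B ** cmat K) = z *s h"
      by (simp add: h_def vector_matrix_mul_assoc[symmetric] vector_matrix_mult_mat scalar_vector_matrix_assoc)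
    then show ?thesis using y by (simp add: vector_matrix_mult_diff_rdistrib algebra_simps)
  qed
  have qF: "q v* cmat (A - G ** C) = \<mu> *s q - z *s h"
    using q by (simp add: h_def vector_matrix_mult_diff_rdistrib vector_matrix_mult_mat algebra_simps)
  have coupling: "(\<Sum>i\<in>UNIV. r$i * (\<Sum>j\<in>UNIV. Lc$i$j * f j)) = z * (\<Sum>j\<in>UNIV. r$j * f j)" for f
  proof -
    have "(\<Sum>i\<in>UNIV. r$i * (\<Sum>j\<in>UNIV. Lc$i$j * f j)) = (\<Sum>j\<in>UNIV. (r v* Lc)$j * f j)"
      by (simp add: vector_matrix_mult_def sum_distrib_left sum_distrib_right mult.assoc) (rule sum.swap)
    then show ?thesis by (simp add: Lc_def r sum_distrib_left mult.assoc)
  qed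
  have state: "(\<Sum>j\<in>UNIV. r$j * cdot y (cvec (X (Suc t) j)))
      = \<mu> * (\<Sum>j\<in>UNIV. r$j * cdot y (cvec (X t j))) + z * (\<Sum>j\<in>UNIV. r$j * cdot h (cvec (E t j)))"
  proof -
    have "cdot y (cvec (X (Suc t) i)) = \<mu> * cdot y (cvec (X t i)) + z * cdot h (cvec (X t i))
        - (\<Sum>j\<in>UNIV. Lc$i$j * cdot h (cvec (XH t j)))" for i
    proof -
      have "cdot y (cvec (X (Suc t) i))
          = cdot (y v* cmat A) (cvec (X t i)) + cdot y (cvec (B *v ctrl K a (XH t) i))"
        by (simp only: X_Suc cvec_add cdot_add cvec_matrix_vector_mult[of A] cdot_matrix_vector_mult)
      then show ?thesis
        unfolding cdot_ctrl_laplacian[OF nonneg] yA by (simp add: cdot_add_left h_def Lc_def)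
    qed
    then have "(\<Sum>i\<in>UNIV. r$i * cdot y (cvec (X (Suc t) i)))
        = (\<Sum>i\<in>UNIV. r$i * (\<mu> * cdot y (cvec (X t i)) + z * cdot h (cvec (X t i))))
          - (\<Sum>i\<in>UNIV. r$i * (\<Sum>j\<in>UNIV. Lc$i$j * cdot h (cvec (XH t j))))"
      by (simp add: right_diff_distrib sum_subtractf)
    also have "\<dots> = (\<Sum>i\<in>UNIV. r$i * (\<mu> * cdot y (cvec (X t i)) + z * cdot h (cvec (X t i))))
          - z * (\<Sum>j\<in>UNIV. r$j * cdot h (cvec (XH t j)))"
      by (simp only: coupling)
    finally show ?thesis
      by (simp add: E_def ring_distribs sum.distrib sum_subtractf sum_distrib_left algebra_simps)
  qed
  have error: "cdot q (cvec (E (Suc t) j))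
      = \<mu> * cdot q (cvec (E t j)) - z * cdot h (cvec (E t j)) + cdot q (cvec (drift t j))" for j
  proof -
    have "E (Suc t) j = (A - G ** C) *v E t j + drift t j" by (simp add: drift_def)
    then have "cdot q (cvec (E (Suc t) j)) = cdot (q v* cmat (A - G ** C)) (cvec (E t j)) + cdot q (cvec (drift t j))"
      by (simp only: cvec_add cdot_add cvec_matrix_vector_mult cdot_matrix_vector_mult)
    then show ?thesis unfolding qF by (simp add: cdot_diff_left)
  qed
  have "(\<Sum>j\<in>UNIV. r$j * cdot q (cvec (E (Suc t) j)))
      = \<mu> * (\<Sum>j\<in>UNIV. r$j * cdot q (cvec (E t j))) - z * (\<Sum>j\<in>UNIV. r$j * cdot h (cvec (E t j)))
        + (\<Sum>j\<in>UNIV. r$j * cdot q (cvec (drift t j)))"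
    by (simp add: error algebra_simps sum.distrib sum_subtractf sum_distrib_left)
  with state show ?thesis
    unfolding consensus_mode_def distrib_left sum.distrib by (simp add: algebra_simps)
qed

lemma consensus_mode_tendsto_zero:
  assumes "(\<Sum>i\<in>UNIV. r$i) = 0" and "\<forall>j. (\<lambda>t. E t j) \<longlonglongrightarrow> 0"
    and "\<forall>i j. (\<lambda>t. X t i - X t j) \<longlonglongrightarrow> 0"
  shows "consensus_mode r y q \<longlonglongrightarrow> 0"
proof -
  obtain j1 :: 'N where True by simp
  have "(\<Sum>j\<in>UNIV. r$j * cdot y (cvec (X t j1))) = 0" for t
    using assms(1) by (simp add: sum_distrib_right[symmetric])
  then have "consensus_mode r y q
      = (\<lambda>t. \<Sum>j\<in>UNIV. r$j * (cdot y (cvec (X t j - X t j1)) + cdot q (cvec (E t j))))"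
    unfolding consensus_mode_def by (simp add: fun_eq_iff algebra_simps sum.distrib sum_subtractf)
  then show ?thesis
    using assms(2,3)
    by (simp only:) (intro tendsto_null_sum tendsto_mult_right_zero tendsto_add_zero cdot_cvec_tendsto_zero; simp)
qed

lemma consensus_mode_initial_le:
  fixes D :: real
  assumes nonneg: "\<forall>i j. a$i$j \<ge> 0"
    and drift: "\<And>t j i. (\<Sum>s<t. \<bar>drift s j $ i\<bar>) \<le> D"
    and E: "\<forall>j. (\<lambda>t. E t j) \<longlonglongrightarrow> 0" and X: "\<forall>i j. (\<lambda>t. X t i - X t j) \<longlonglongrightarrow> 0"
    and r: "r v* cmat (laplacian a) = z *s r" "(\<Sum>i\<in>UNIV. r$i) = 0" "\<forall>j. cmod (r$j) \<le> 1"
    and y: "y v* (cmat A - mat z ** cmat B ** cmat K) = \<mu> *s y"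
    and q: "q v* (mat \<mu> - cmat (A - G ** C)) = z *s (y v* (cmat B ** cmat K))" "\<forall>i. cmod (q$i) \<le> 1"
    and \<mu>: "1 \<le> cmod \<mu>"
  shows "cmod (consensus_mode r y q 0) \<le> CARD('N) * (CARD('n) * D)"
proof (rule recursion_tendsto_zero_initial_le[where \<zeta> = "consensus_mode r y q"
      and \<delta> = "\<lambda>t. \<Sum>j\<in>UNIV. r$j * cdot q (cvec (drift t j))"])
  fix t
  show "consensus_mode r y q (Suc t)
      = \<mu> * consensus_mode r y q t + (\<Sum>j\<in>UNIV. r$j * cdot q (cvec (drift t j)))"
    by (rule consensus_mode_Suc[OF nonneg r(1) y q(1)])
  have "(\<Sum>s<t. cmod (\<Sum>j\<in>UNIV. r$j * cdot q (cvec (drift s j))))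
      \<le> (\<Sum>s<t. \<Sum>j\<in>UNIV. cmod (cdot q (cvec (drift s j))))"
  proof (intro sum_mono)
    fix s
    have "cmod (\<Sum>j\<in>UNIV. r$j * cdot q (cvec (drift s j))) \<le> (\<Sum>j\<in>UNIV. cmod (r$j * cdot q (cvec (drift s j))))"
      by (rule norm_sum)
    also have "\<dots> = (\<Sum>j\<in>UNIV. cmod (r$j) * cmod (cdot q (cvec (drift s j))))"
      by (simp add: norm_mult)
    also have "\<dots> \<le> (\<Sum>j\<in>UNIV. cmod (cdot q (cvec (drift s j))))"
      using r(3) by (intro sum_mono) (simp add: mult_left_le_one_le)
    finally show "cmod (\<Sum>j\<in>UNIV. r$j * cdot q (cvec (drift s j))) \<le> \<dots>" .
  qed
  also have "\<dots> = (\<Sum>j\<in>UNIV. \<Sum>s<t. cmod (cdot q (cvec (drift s j))))"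
    by (rule sum.swap)
  also have "\<dots> \<le> (\<Sum>j\<in>(UNIV::'N set). CARD('n) * D)"
    using q(2) drift by (intro sum_mono sum_norm_cdot_cvec_le)
  finally show "(\<Sum>s<t. cmod (\<Sum>j\<in>UNIV. r$j * cdot q (cvec (drift s j)))) \<le> CARD('N) * (CARD('n) * D)"
    by simp
next
  show "1 \<le> cmod \<mu>" by (rule \<mu>)
  show "consensus_mode r y q \<longlonglongrightarrow> 0" by (rule consensus_mode_tendsto_zero[OF r(2) E X])
qed

end

section \<open>Stability forced by the protocols\<close>

lemma protocol_achieves_imp_observer_stable:
  fixes A :: "real^'n^'n" and B :: "real^'m^'n" and C :: "real^'n^'p" and a :: "real^'N::finite^'N"
    and G :: "real^'p^'n" and K :: "real^'n^'m"
  assumes \<gamma>: "0 < \<gamma>" "\<gamma> < 1"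
    and achieves: "protocol_achieves A B C a \<gamma> \<alpha> \<alpha>u L Lu G K W Wu Cx Cxh Cuh"
    and s: "CARD('n) * drift_bound B G W Wu \<gamma> < s" "0 \<le> s" "s < Cx"
    and "0 < Cxh" "0 < Cuh"
  shows "schur_stable (cmat (A - G ** C))"
  unfolding schur_stable_def
proof (intro allI impI, rule ccontr)
  fix \<mu> assume root: "poly (charpoly (cmat (A - G ** C))) \<mu> = 0" and "\<not> cmod \<mu> < 1"
  obtain y0 where y0: "y0 \<noteq> 0" "y0 v* cmat (A - G ** C) = \<mu> *s y0"
    using charpoly_root_imp_left_eigenvector[OF root] by blast
  obtain c k where c: "(c *s y0)$k = 1" "\<forall>i. cmod ((c *s y0)$i) \<le> 1"
    using scale_to_unit_max_component[OF y0(1)] by metis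
  obtain j :: 'N where True by simp
  interpret quantized_closed_loop A B C a \<gamma> \<alpha> \<alpha>u L Lu G K
      "\<lambda>j. axis k s" "\<lambda>j. 0" "\<lambda>j. 0"
    by unfold_locales (rule \<gamma>(1))
  have admissible: "stack_infnorm (\<lambda>j::'N. axis k s :: real^'n) < Cx"
      "stack_infnorm (\<lambda>j::'N. 0::real^'n) < Cxh" "stack_infnorm (\<lambda>j::'N. 0::real^'m) < Cuh"
    using s assms(7,8) abs_axis_nth_le
    by (auto intro!: stack_infnorm_le_less stack_infnorm_zero_less)
  note run = protocol_achievesD[OF achieves admissible]
  have "cmod (cdot (c *s y0) (cvec (E 0 j))) \<le> CARD('n) * drift_bound B G W Wu \<gamma>"
  proof (rule observer_mode_initial_le)
    show "(\<Sum>s<t. \<bar>drift s j $ i\<bar>) \<le> drift_bound B G W Wu \<gamma>" for t i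
      using run(3,4) \<gamma>(2) by (intro sum_abs_drift_le) (auto simp: ctrl_def)
    show "(c *s y0) v* cmat (A - G ** C) = \<mu> *s (c *s y0)"
      by (simp only: scalar_vector_matrix_assoc y0(2)) (simp add: vector_smult_assoc mult.commute)
  qed (use run(1) c(2) \<open>\<not> cmod \<mu> < 1\<close> in auto)
  moreover have "cdot (c *s y0) (cvec (E 0 j)) = complex_of_real s"
    using c(1) by (simp add: E_def X_0 XH_0 cdot_cvec_axis)
  ultimately show False using s by simp
qed

lemma scale_pair_to_unit_max_component:
  fixes y q :: "complex^'n"
  assumes "y \<noteq> 0"
  obtains c k where "c \<noteq> 0" "\<forall>i. cmod ((c *s q)$i) \<le> 1" "(c *s q)$k = 1 \<or> q = 0 \<and> (c *s y)$k = 1"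
proof (cases "q = 0")
  case True
  then show ?thesis
    using scale_to_unit_max_component[OF assms] that by (metis norm_zero vector_smult_rzero zero_index zero_le_one)
next
  case False
  then show ?thesis
    using scale_to_unit_max_component[OF False] that by metis
qed

lemma consensus_mode_witness:
  fixes r :: "complex^'N::finite" and y q :: "complex^'n"
  assumes "r$j0 = 1" "0 \<le> s" "q$k = 1 \<or> q = 0 \<and> y$k = 1"
  obtains x0 xh0 :: "'N \<Rightarrow> real^'n"
  where "\<forall>j l. \<bar>x0 j $ l\<bar> \<le> s" "\<forall>j l. \<bar>xh0 j $ l\<bar> \<le> s"
    "(\<Sum>j\<in>UNIV. r$j * (cdot y (cvec (x0 j)) + cdot q (cvec (x0 j - xh0 j)))) = s"
proof (cases "q$k = 1")
  case True
  let ?xh0 = "\<lambda>j. if j = j0 then - (axis k s) else 0"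
  have "r$j * (cdot y (cvec 0) + cdot q (cvec (0 - ?xh0 j))) = (if j = j0 then complex_of_real s else 0)" for j
    using assms(1) True by (simp add: cdot_cvec_axis)
  then show ?thesis
    using that[of "\<lambda>j. 0" ?xh0] assms(2) abs_axis_nth_le by (simp add: abs_axis_nth_le)
next
  case False
  let ?x0 = "\<lambda>j. if j = j0 then axis k s else 0"
  have "r$j * (cdot y (cvec (?x0 j)) + cdot q (cvec (?x0 j - ?x0 j))) = (if j = j0 then complex_of_real s else 0)" for j
    using assms False by (simp add: cdot_cvec_axis)
  then show ?thesis
    using that[of ?x0 ?x0] assms(2) by (simp add: abs_axis_nth_le)
qed

lemma protocol_achieves_consensus_mode_le:
  fixes A :: "real^'n^'n" and B :: "real^'m^'n" and C :: "real^'n^'p" and a :: "real^'N::finite^'N"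
    and G :: "real^'p^'n" and K :: "real^'n^'m"
  assumes nonneg: "\<forall>i j. a$i$j \<ge> 0" and \<gamma>: "0 < \<gamma>" "\<gamma> < 1"
    and achieves: "protocol_achieves A B C a \<gamma> \<alpha> \<alpha>u L Lu G K W Wu Cx Cxh Cuh"
    and s: "s < Cx" "s < Cxh"
    and ctrl_small: "\<And>xh. \<forall>j l. \<bar>xh j $ l\<bar> \<le> s \<Longrightarrow> stack_infnorm (ctrl K a xh) < Cuh"
    and r: "r v* cmat (laplacian a) = z *s r" "(\<Sum>i\<in>UNIV. r$i) = 0" "\<forall>j. cmod (r$j) \<le> 1"
    and y: "y v* (cmat A - mat z ** cmat B ** cmat K) = \<mu> *s y"
    and q: "q v* (mat \<mu> - cmat (A - G ** C)) = z *s (y v* (cmat B ** cmat K))" "\<forall>i. cmod (q$i) \<le> 1"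
    and \<mu>: "1 \<le> cmod \<mu>"
    and x0: "\<forall>j l. \<bar>x0 j $ l\<bar> \<le> s" and xh0: "\<forall>j l. \<bar>xh0 j $ l\<bar> \<le> s"
  shows "cmod (\<Sum>j\<in>UNIV. r$j * (cdot y (cvec (x0 j)) + cdot q (cvec (x0 j - xh0 j))))
    \<le> CARD('N) * (CARD('n) * drift_bound B G W Wu \<gamma>)"
proof -
  interpret quantized_closed_loop A B C a \<gamma> \<alpha> \<alpha>u L Lu G K x0 xh0 "ctrl K a xh0"
    by unfold_locales (rule \<gamma>(1))
  have "stack_infnorm x0 < Cx" "stack_infnorm xh0 < Cxh" "stack_infnorm (ctrl K a xh0) < Cuh"
    using s x0 xh0 ctrl_small by (auto intro: stack_infnorm_le_less)
  note run = protocol_achievesD[OF achieves this]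
  have "cmod (consensus_mode r y q 0) \<le> CARD('N) * (CARD('n) * drift_bound B G W Wu \<gamma>)"
    using run(3,4) \<gamma>(2)
    by (intro consensus_mode_initial_le[OF nonneg _ run(1,2) r y q \<mu>] sum_abs_drift_le) auto
  then show ?thesis
    by (simp add: consensus_mode_def E_def X_0 XH_0)
qed

lemma protocol_achieves_imp_closed_loop_stable:
  fixes A :: "real^'n^'n" and B :: "real^'m^'n" and C :: "real^'n^'p" and a :: "real^'N::finite^'N"
    and G :: "real^'p^'n" and K :: "real^'n^'m"
  assumes nonneg: "\<forall>i j. a$i$j \<ge> 0" and \<gamma>: "0 < \<gamma>" "\<gamma> < 1"
    and achieves: "protocol_achieves A B C a \<gamma> \<alpha> \<alpha>u L Lu G K W Wu Cx Cxh Cuh"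
    and s: "CARD('N) * (CARD('n) * drift_bound B G W Wu \<gamma>) < s" "0 \<le> s" "s < Cx" "s < Cxh"
    and ctrl_small: "\<And>xh. \<forall>j l. \<bar>xh j $ l\<bar> \<le> s \<Longrightarrow> stack_infnorm (ctrl K a xh) < Cuh"
    and observer_stable: "schur_stable (cmat (A - G ** C))"
    and z: "z \<in> lap_eigs_rest a"
  shows "schur_stable (cmat A - mat z ** cmat B ** cmat K)"
  unfolding schur_stable_def
proof (intro allI impI, rule ccontr)
  fix \<mu> assume root: "poly (charpoly (cmat A - mat z ** cmat B ** cmat K)) \<mu> = 0" and "\<not> cmod \<mu> < 1"
  then have \<mu>: "1 \<le> cmod \<mu>" by simp
  obtain r0 where r0: "r0 \<noteq> 0" "r0 v* cmat (laplacian a) = z *s r0" "(\<Sum>i\<in>UNIV. r0$i) = 0"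
    using lap_eigs_rest_left_eigenvector[OF z] by blast
  obtain cr j0 where cr: "(cr *s r0)$j0 = 1" "\<forall>i. cmod ((cr *s r0)$i) \<le> 1"
    using scale_to_unit_max_component[OF r0(1)] by metis
  have r: "(cr *s r0) v* cmat (laplacian a) = z *s (cr *s r0)" "(\<Sum>i\<in>UNIV. (cr *s r0)$i) = 0"
    using r0 by (simp_all add: scalar_vector_matrix_assoc vector_smult_assoc mult.commute
        sum_distrib_left[symmetric])
  obtain y0 where y0: "y0 \<noteq> 0" "y0 v* (cmat A - mat z ** cmat B ** cmat K) = \<mu> *s y0"
    using charpoly_root_imp_left_eigenvector[OF root] by blast
  have "det (mat \<mu> - cmat (A - G ** C)) \<noteq> 0"
    using observer_stable \<mu> unfolding schur_stable_def poly_charpoly by fastforce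
  then obtain R where R: "R ** (mat \<mu> - cmat (A - G ** C)) = mat 1"
    using invertible_det_nz invertible_left_inverse by blast
  define q0 where "q0 = (z *s (y0 v* (cmat B ** cmat K))) v* R"
  have q0: "q0 v* (mat \<mu> - cmat (A - G ** C)) = z *s (y0 v* (cmat B ** cmat K))"
    unfolding q0_def vector_matrix_mul_assoc R by simp
  obtain c k where c: "c \<noteq> 0" "\<forall>i. cmod ((c *s q0)$i) \<le> 1"
    and k: "(c *s q0)$k = 1 \<or> c *s q0 = 0 \<and> (c *s y0)$k = 1"
    using scale_pair_to_unit_max_component[OF y0(1), of q0] by auto
  have y: "(c *s y0) v* (cmat A - mat z ** cmat B ** cmat K) = \<mu> *s (c *s y0)"
    and q: "(c *s q0) v* (mat \<mu> - cmat (A - G ** C)) = z *s ((c *s y0) v* (cmat B ** cmat K))"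
    using y0(2) q0 by (simp_all only: scalar_vector_matrix_assoc) (simp_all add: vector_smult_assoc mult.commute)
  obtain x0 xh0 :: "'N \<Rightarrow> real^'n" where "\<forall>j l. \<bar>x0 j $ l\<bar> \<le> s" "\<forall>j l. \<bar>xh0 j $ l\<bar> \<le> s"
    and witness: "(\<Sum>j\<in>UNIV. (cr *s r0)$j * (cdot (c *s y0) (cvec (x0 j)) + cdot (c *s q0) (cvec (x0 j - xh0 j)))) = s"
    using consensus_mode_witness[OF cr(1) s(2) k] by blast
  from protocol_achieves_consensus_mode_le[OF nonneg \<gamma> achieves s(3,4) ctrl_small r cr(2) y q c(2) \<mu> this(1,2)]
  show False using s(1) unfolding witness by simp
qed

lemma achievable_protocols_imp_stable:
  fixes A :: "real^'n^'n" and B :: "real^'m^'n" and C :: "real^'n^'p" and a :: "real^'N::finite^'N"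
  assumes nonneg: "\<forall>i j. a$i$j \<ge> 0" and "0 \<le> LG" "0 < LK" "\<rho> < 1" "0 \<le> W" "0 \<le> Wu"
    and achievable: "\<forall>Cx>0. \<forall>Cxh>0. \<forall>Cuh>0. \<exists>\<gamma> \<alpha> \<alpha>u L Lu G K.
      0 < \<gamma> \<and> \<gamma> < \<rho> \<and> 0 < \<alpha> \<and> \<alpha> \<le> 1 \<and> 0 < \<alpha>u \<and> \<alpha>u \<le> 1 \<and> 0 < L \<and> 0 < Lu \<and>
      onorm ((*v) G) < LG \<and> onorm ((*v) K) < LK \<and> protocol_achieves A B C a \<gamma> \<alpha> \<alpha>u L Lu G K W Wu Cx Cxh Cuh"
  shows "\<exists>(G::real^'p^'n) (K::real^'n^'m). schur_stable (cmat (A - G ** C)) \<and>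
    (\<forall>z\<in>lap_eigs_rest a. schur_stable (cmat A - mat z ** cmat B ** cmat K))"
proof -
  define D where "D = (LG * (sqrt CARD('p) * W) + onorm ((*v) B) * (sqrt CARD('m) * Wu)) / (1 - \<rho>)"
  define s where "s = CARD('N) * (CARD('n) * D) + 1"
  define Cu where "Cu = LK * (sqrt CARD('n) * (2 * s * (\<Sum>i\<in>UNIV. \<Sum>j\<in>UNIV. a$i$j))) + 1"
  have "0 \<le> D"
    unfolding D_def using assms by (simp add: onorm_pos_le[OF matrix_vector_mul_bounded_linear])
  then have s: "0 < s" "CARD('n) * D \<le> CARD('N) * (CARD('n) * D)"
    using mult_right_mono[of 1 "real CARD('N)" "CARD('n) * D"] unfolding s_def
    by (simp_all add: add_nonneg_pos)
  have "0 < Cu"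
    unfolding Cu_def using assms s(1) by (intro add_nonneg_pos mult_nonneg_nonneg sum_nonneg) auto
  with s obtain \<gamma> \<alpha> \<alpha>u L Lu G K where \<gamma>: "0 < \<gamma>" "\<gamma> < \<rho>"
    and "onorm ((*v) G) < LG" "onorm ((*v) K) < LK"
    and achieves: "protocol_achieves A B C a \<gamma> \<alpha> \<alpha>u L Lu G K W Wu (s + 1) (s + 1) Cu"
    using achievable[rule_format, of "s + 1" "s + 1" Cu] by auto
  then have "drift_bound B G W Wu \<gamma> \<le> D"
    using drift_bound_le[of G LG \<gamma> \<rho> W Wu B] assms unfolding D_def by auto
  then have "CARD('n) * drift_bound B G W Wu \<gamma> \<le> CARD('n) * D"
    by (simp add: mult_left_mono)
  moreover from this have "CARD('N) * (CARD('n) * drift_bound B G W Wu \<gamma>) \<le> CARD('N) * (CARD('n) * D)"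
    by (simp add: mult_left_mono)
  ultimately have bounds: "CARD('n) * drift_bound B G W Wu \<gamma> < s"
      "CARD('N) * (CARD('n) * drift_bound B G W Wu \<gamma>) < s"
    using s(2) unfolding s_def by linarith+
  have ctrl_small: "stack_infnorm (ctrl K a xh) < Cu" if "\<forall>j l. \<bar>xh j $ l\<bar> \<le> s" for xh
    using \<open>onorm ((*v) K) < LK\<close>
    by (intro stack_infnorm_ctrl_less[OF nonneg that, where LK = LK]) (auto simp: Cu_def)
  have \<gamma>1: "\<gamma> < 1" using \<gamma> assms by simp
  have observer: "schur_stable (cmat (A - G ** C))"
    using s(1) \<open>0 < Cu\<close>
    by (intro protocol_achieves_imp_observer_stable[OF \<gamma>(1) \<gamma>1 achieves bounds(1)]) auto
  moreover have "\<forall>z\<in>lap_eigs_rest a. schur_stable (cmat A - mat z ** cmat B ** cmat K)"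
    using s(1) by (intro ballI protocol_achieves_imp_closed_loop_stable[OF nonneg \<gamma>(1) \<gamma>1 achieves
          bounds(2) _ _ _ ctrl_small observer]) auto
  ultimately show ?thesis by blast
qed

theorem theorem3:
  fixes A :: "real^'n^'n" and B :: "real^'m^'n" and C :: "real^'n^'p"
    and a :: "real^'N::finite^'N"
    and LG LK \<rho> :: real
  assumes adj_diag: "\<forall>i. a$i$i = 0"
    and adj_nonneg: "\<forall>i j. a$i$j \<ge> 0"
    and LG_pos: "LG > 0" and LK_pos: "LK > 0"
    and rho: "0 < \<rho>" "\<rho> < 1"
    and hyp: "\<exists>W>0. \<exists>Wu>0. \<forall>Cx>0. \<forall>Cxh>0. \<forall>Cuh>0.
      \<exists>(\<gamma>::real) (\<alpha>::real) (\<alpha>u::real) (L::nat) (Lu::nat) (G::real^'p^'n) (K::real^'n^'m).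
        0 < \<gamma> \<and> \<gamma> < \<rho> \<and> 0 < \<alpha> \<and> \<alpha> \<le> 1 \<and> 0 < \<alpha>u \<and> \<alpha>u \<le> 1 \<and> 0 < L \<and> 0 < Lu \<and>
        onorm (\<lambda>v. G *v v) < LG \<and> onorm (\<lambda>v. K *v v) < LK \<and>
        (\<forall>(x0::'N \<Rightarrow> real^'n) (xh0::'N \<Rightarrow> real^'n) (uh0::'N \<Rightarrow> real^'m).
           stack_infnorm x0 < Cx \<and> stack_infnorm xh0 < Cxh \<and> stack_infnorm uh0 < Cuh \<longrightarrow>
           (\<forall>j. (\<lambda>t. fst (cl A B C a \<gamma> \<alpha> \<alpha>u L Lu G K x0 xh0 uh0 t) j
                     - fst (snd (cl A B C a \<gamma> \<alpha> \<alpha>u L Lu G K x0 xh0 uh0 t)) j) \<longlonglongrightarrow> 0) \<and>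
           (\<forall>i j. (\<lambda>t. fst (cl A B C a \<gamma> \<alpha> \<alpha>u L Lu G K x0 xh0 uh0 t) i
                     - fst (cl A B C a \<gamma> \<alpha> \<alpha>u L Lu G K x0 xh0 uh0 t) j) \<longlonglongrightarrow> 0) \<and>
           (\<forall>t j. infnorm (qerr A B C a \<gamma> \<alpha> \<alpha>u L Lu G K x0 xh0 uh0 t j) \<le> W) \<and>
           (\<forall>t j. infnorm (qerr_u A B C a \<gamma> \<alpha> \<alpha>u L Lu G K x0 xh0 uh0 t j) \<le> Wu))"
  shows "(\<exists>K :: real^'n^'m. \<forall>z\<in>lap_eigs_rest a.
            schur_stable (cmat A - mat z ** cmat B ** cmat K))
         \<and> detectable A C"
proof -
  have "\<exists>W>0. \<exists>Wu>0. \<forall>Cx>0. \<forall>Cxh>0. \<forall>Cuh>0. \<exists>\<gamma> \<alpha> \<alpha>u L Lu G K.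
      0 < \<gamma> \<and> \<gamma> < \<rho> \<and> 0 < \<alpha> \<and> \<alpha> \<le> 1 \<and> 0 < \<alpha>u \<and> \<alpha>u \<le> 1 \<and> 0 < L \<and> 0 < Lu \<and>
      onorm ((*v) G) < LG \<and> onorm ((*v) K) < LK \<and> protocol_achieves A B C a \<gamma> \<alpha> \<alpha>u L Lu G K W Wu Cx Cxh Cuh"
    using hyp unfolding protocol_achieves_def .
  then have "\<exists>(G::real^'p^'n) (K::real^'n^'m). schur_stable (cmat (A - G ** C)) \<and>
      (\<forall>z\<in>lap_eigs_rest a. schur_stable (cmat A - mat z ** cmat B ** cmat K))"
    using LG_pos LK_pos rho(2)
    by (elim exE conjE) (intro achievable_protocols_imp_stable[OF adj_nonneg] less_imp_le; assumption)
  then show ?thesis unfolding detectable_def by blast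
qed

end
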